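(* Let $k_{-1},k_0,k_1$ be nonnegative integers, $n=k_{-1}+k_0+k_1$, and let $t$ be an integer. Put $$\mathcal B=\bigl\{(l_{1,1},l_{-1,-1},l_{-1,1},l_{1,-1})\in\mathbb Z^4 : 0\le l_{1,1}\le k_1,\ 0\le l_{-1,-1}\le k_{-1},\ 0\le l_{-1,1}\le \min(k_{-1}-l_{-1,-1},\,k_1-l_{1,1}),\ 0\le l_{1,-1}\le \min(k_{-1}-l_{-1,-1},\,k_1-l_{1,1})\bigr\},$$ let $P(l_{1,1},l_{-1,1},l_{-1,-1},l_{1,-1},t)=1$ if $l_{1,1}-l_{-1,1}+l_{-1,-1}-l_{1,-1}\ge t$ and $0$ otherwise, and define $$d(n,k_{-1},k_0,k_1,t)=\sum_{(l_{1,1},l_{-1,-1},l_{-1,1},l_{1,-1})\in\mathcal B}\binom{k_1}{l_{1,1}}\binom{k_1-l_{1,1}}{l_{1,-1}}\binom{k_{-1}}{l_{-1,-1}}\binom{k_{-1}-l_{-1,-1}}{l_{-1,1}}\binom{k_0}{k_1-l_{1,1}-l_{-1,1}}\binom{k_0-k_1+l_{1,1}+l_{-1,1}}{k_{-1}-l_{-1,-1}-l_{1,-1}}\,P(l_{1,1},l_{-1,1},l_{-1,-1},l_{1,-1},t).$$ Suppose that $d(n,k_{-1},k_0,k_1,t)\neq 0$. Then $$m(n,k_{-1},k_0,k_1,t)\ \ge\ h(n,k_{-1},k_0,k_1,t)\ \ge\ \left\lceil \frac{|V_n(k_{-1},k_0,k_1)|}{d(n,k_{-1},k_0,k_1,t)}\right\rceil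 .$$
   Context: For nonnegative integers $k_{-1},k_0,k_1$ with $k_{-1}+k_0+k_1=n$, $V_n(k_{-1},k_0,k_1)$ is the set of vectors $\mathbf x\in\{-1,0,1\}^n$ having exactly $k_{-1}$ coordinates equal to $-1$, exactly $k_0$ equal to $0$ and exactly $k_1$ equal to $1$. $(\mathbf x,\mathbf y)$ denotes the standard dot product. For an integer $t$: $m(n,k_{-1},k_0,k_1,t)$ is the maximum of $|W|$ over subsets $W\subset V_n(k_{-1},k_0,k_1)$ with $(\mathbf x,\mathbf y)\ne t$ for all distinct $\mathbf x,\mathbf y\in W$ (the independence number of the graph on $V_n(k_{-1},k_0,k_1)$ whose edges are the pairs with dot product $t$); $h(n,k_{-1},k_0,k_1,t)$ is the maximum of $|W|$ over subsets $W\subset V_n(k_{-1},k_0,k_1)$ with $(\mathbf x,\mathbf y)<t$ for all distinct $\mathbf x,\mathbf y\in W$. Convention: $\binom{a}{b}=0$ unless $0\le b\le a$. *)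

theory Defs
  imports Complex_Main "Jordan_Normal_Form.Matrix"
begin

definition ternary_vecs :: "nat \<Rightarrow> nat \<Rightarrow> nat \<Rightarrow> nat \<Rightarrow> int vec set" where
  "ternary_vecs n km1 k0 k1 =
     {x \<in> carrier_vec n.
        (\<forall>i<n. x $ i \<in> {-1, 0, 1}) \<and>
        card {i. i < n \<and> x $ i = -1} = km1 \<and>
        card {i. i < n \<and> x $ i = 0} = k0 \<and>
        card {i. i < n \<and> x $ i = 1} = k1}"

definition m_num :: "nat \<Rightarrow> nat \<Rightarrow> nat \<Rightarrow> nat \<Rightarrow> int \<Rightarrow> nat" where
  "m_num n km1 k0 k1 t =
     Max {card W | W. W \<subseteq> ternary_vecs n km1 k0 k1 \<and> pairwise (\<lambda>x y. x \<bullet> y \<noteq> t) W}"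

definition h_num :: "nat \<Rightarrow> nat \<Rightarrow> nat \<Rightarrow> nat \<Rightarrow> int \<Rightarrow> nat" where
  "h_num n km1 k0 k1 t =
     Max {card W | W. W \<subseteq> ternary_vecs n km1 k0 k1 \<and> pairwise (\<lambda>x y. x \<bullet> y < t) W}"

text \<open>Binomial coefficient on integer arguments, zero unless \<open>0 \<le> b \<le> a\<close>.
  Both arguments can be negative in the summands of \<open>d_num\<close> below, so truncated
  subtraction on natural numbers is avoided.\<close>

definition int_binom :: "int \<Rightarrow> int \<Rightarrow> nat" where
  "int_binom a b = (if 0 \<le> b \<and> b \<le> a then nat a choose nat b else 0)"

text \<open>Tuples are ordered \<open>(l\<^sub>1\<^sub>,\<^sub>1, l\<^sub>-\<^sub>1\<^sub>,\<^sub>-\<^sub>1, l\<^sub>-\<^sub>1\<^sub>,\<^sub>1, l\<^sub>1\<^sub>,\<^sub>-\<^sub>1)\<close>; in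
  variable names, \<open>p\<close> stands for the index \<open>1\<close> and \<open>m\<close> for \<open>-1\<close>.\<close>

definition B_set :: "nat \<Rightarrow> nat \<Rightarrow> (int \<times> int \<times> int \<times> int) set" where
  "B_set km1 k1 =
     {(lpp, lmm, lmp, lpm).
        0 \<le> lpp \<and> lpp \<le> int k1 \<and>
        0 \<le> lmm \<and> lmm \<le> int km1 \<and>
        0 \<le> lmp \<and> lmp \<le> min (int km1 - lmm) (int k1 - lpp) \<and>
        0 \<le> lpm \<and> lpm \<le> min (int km1 - lmm) (int k1 - lpp)}"

text \<open>The order of the arguments differs from that of the tuples in \<open>B_set\<close>.\<close>

definition P_ind :: "int \<Rightarrow> int \<Rightarrow> int \<Rightarrow> int \<Rightarrow> int \<Rightarrow> nat" where
  "P_ind lpp lmp lmm lpm t = (if lpp - lmp + lmm - lpm \<ge> t then 1 else 0)"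

text \<open>The argument \<open>n\<close> does not occur in the formula; it is kept for uniformity with
  \<open>m_num\<close> and \<open>h_num\<close>.\<close>

definition d_num :: "nat \<Rightarrow> nat \<Rightarrow> nat \<Rightarrow> nat \<Rightarrow> int \<Rightarrow> nat" where
  "d_num n km1 k0 k1 t =
     (\<Sum>(lpp, lmm, lmp, lpm) \<in> B_set km1 k1.
        int_binom (int k1) lpp *
        int_binom (int k1 - lpp) lpm *
        int_binom (int km1) lmm *
        int_binom (int km1 - lmm) lmp *
        int_binom (int k0) (int k1 - lpp - lmp) *
        int_binom (int k0 - int k1 + lpp + lmp) (int km1 - lmm - lpm) *
        P_ind lpp lmp lmm lpm t)"

text \<open>Finiteness of the sets above, so that \<open>Max\<close>, \<open>card\<close> and the sum
  do not take their default values.\<close>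

lemma finite_ternary_vecs: "finite (ternary_vecs n km1 k0 k1)"
proof (rule finite_subset)
  show "ternary_vecs n km1 k0 k1 \<subseteq> vec_of_list ` {xs. set xs \<subseteq> {-1, 0, 1} \<and> length xs = n}"
  proof
    fix x assume x: "x \<in> ternary_vecs n km1 k0 k1"
    then have "set (list_of_vec x) \<subseteq> {-1, 0, 1} \<and> length (list_of_vec x) = n"
      by (auto simp: ternary_vecs_def set_list_of_vec vec_set_def)
    moreover have "x = vec_of_list (list_of_vec x)"
      by (simp add: vec_list)
    ultimately show "x \<in> vec_of_list ` {xs. set xs \<subseteq> {-1, 0, 1} \<and> length xs = n}"
      by blast
  qed
  show "finite (vec_of_list ` {xs :: int list. set xs \<subseteq> {-1, 0, 1} \<and> length xs = n})"
    by (intro finite_imageI finite_lists_length_eq) auto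
qed

lemma finite_card_pairwise_subsets:
  "finite {card W | W. W \<subseteq> ternary_vecs n km1 k0 k1 \<and> pairwise R W}"
  using finite_ternary_vecs by simp

lemma card_pairwise_subsets_nonempty:
  "{card W | W. W \<subseteq> ternary_vecs n km1 k0 k1 \<and> pairwise R W} \<noteq> {}"
  by (auto intro: exI[of _ "{}"])

lemma finite_B_set: "finite (B_set km1 k1)"
  by (rule finite_subset[of _ "{0..int k1} \<times> {0..int km1} \<times> {0..int km1} \<times> {0..int k1}"])
    (auto simp: B_set_def)

end

theory Submission
  imports Defs
begin

text \<open>A largest set \<open>W\<close> with all dot products below \<open>t\<close> is maximal, so the sets
  \<open>{y. w \<bullet> y \<ge> t}\<close> with \<open>w \<in> W\<close> cover \<open>V\<close> (unless \<open>t\<close> exceeds every dot product, when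
  \<open>W = V\<close>). Each of them has at most \<open>d\<close> elements: classify \<open>y\<close> by the numbers of coordinates
  at which \<open>w\<close> and \<open>y\<close> take given nonzero values.\<close>

section \<open>Coordinate sets and the number of disjoint pairs of subsets\<close>

definition level_set :: "int vec \<Rightarrow> int \<Rightarrow> nat set" where
  "level_set x a = {i. i < dim_vec x \<and> x $ i = a}"

definition joint_level :: "int vec \<Rightarrow> int vec \<Rightarrow> int \<Rightarrow> int \<Rightarrow> nat set" where
  "joint_level x y a b = level_set x a \<inter> level_set y b"

text \<open>The sizes are integers because the differences supplied as \<open>a\<close> and
  \<open>b\<close> later may be negative; the set is then empty, in line with the zero convention of
  \<open>int_binom\<close>.\<close>

definition disjoint_pairs :: "'a set \<Rightarrow> int \<Rightarrow> int \<Rightarrow> ('a set \<times> 'a set) set" where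
  "disjoint_pairs S a b =
     {(A, B). A \<subseteq> S \<and> B \<subseteq> S - A \<and> int (card A) = a \<and> int (card B) = b}"

lemma card_subsets_int_binom:
  assumes "finite S"
  shows "card {A. A \<subseteq> S \<and> int (card A) = a} = int_binom (int (card S)) a"
proof (cases "0 \<le> a")
  case True
  then have "{A. A \<subseteq> S \<and> int (card A) = a} = {A. A \<subseteq> S \<and> card A = nat a}"
    by auto
  then show ?thesis
    using True n_subsets[OF assms, of "nat a"] by (auto simp: int_binom_def)
next
  case False
  then have "{A. A \<subseteq> S \<and> int (card A) = a} = {}"
    by auto
  with False show ?thesis
    by (simp add: int_binom_def)
qed

text \<open>Choose \<open>A\<close> first, then \<open>B\<close> among the \<open>card S - a\<close>
  elements left: the number of choices for \<open>B\<close> depends on \<open>A\<close> only through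
  its size. If no \<open>A\<close> of size \<open>a\<close> exists, both sides vanish.\<close>

lemma card_disjoint_pairs:
  assumes "finite S"
  shows "card (disjoint_pairs S a b) =
    int_binom (int (card S)) a * int_binom (int (card S) - a) b"
proof -
  have eq: "disjoint_pairs S a b =
      (SIGMA A:{A. A \<subseteq> S \<and> int (card A) = a}. {B. B \<subseteq> S - A \<and> int (card B) = b})"
    by (auto simp: disjoint_pairs_def)
  have "card {B. B \<subseteq> S - A \<and> int (card B) = b} = int_binom (int (card S) - a) b"
    if "A \<subseteq> S" "int (card A) = a" for A
  proof -
    have "int (card (S - A)) = int (card S) - a"
      using that assms by (simp add: card_Diff_subset finite_subset card_mono)
    then show ?thesis
      using card_subsets_int_binom[of "S - A" b] assms by simp
  qed
  then show ?thesis
    unfolding eq using assms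
    by (subst card_SigmaI) (auto simp: card_subsets_int_binom)
qed

lemma finite_disjoint_pairs: "finite S \<Longrightarrow> finite (disjoint_pairs S a b)"
  by (rule finite_subset[of _ "Pow S \<times> Pow S"]) (auto simp: disjoint_pairs_def)

lemma finite_level_set [simp]: "finite (level_set x a)"
  by (simp add: level_set_def)

lemma finite_joint_level [simp]: "finite (joint_level x y a b)"
  by (simp add: joint_level_def)

section \<open>Dot products of ternary vectors through joint levels\<close>

lemma ternary_vecsD:
  assumes "x \<in> ternary_vecs n km1 k0 k1"
  shows "dim_vec x = n"
    and "i < n \<Longrightarrow> x $ i = -1 \<or> x $ i = 0 \<or> x $ i = 1"
    and "card (level_set x (-1)) = km1"
    and "card (level_set x 0) = k0"
    and "card (level_set x 1) = k1"
  using assms by (auto simp: ternary_vecs_def level_set_def)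

lemma joint_level_commute: "joint_level x y a b = joint_level y x b a"
  by (auto simp: joint_level_def)

text \<open>The entries of \<open>x\<close> lie in {-1, 0, 1}, so its three level sets partition the
  coordinates.\<close>

lemma card_level_set_split:
  assumes x: "x \<in> ternary_vecs n km1 k0 k1" and y: "dim_vec y = n"
  shows "card (level_set y b) =
    card (joint_level x y (-1) b) + card (joint_level x y 0 b) + card (joint_level x y 1 b)"
proof -
  have "level_set y b = (joint_level x y (-1) b \<union> joint_level x y 0 b) \<union> joint_level x y 1 b"
    using ternary_vecsD(1,2)[OF x] y by (auto simp: joint_level_def level_set_def)
  also have "card \<dots> =
      card (joint_level x y (-1) b \<union> joint_level x y 0 b) + card (joint_level x y 1 b)"
    by (intro card_Un_disjoint) (auto simp: joint_level_def level_set_def)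
  also have "card (joint_level x y (-1) b \<union> joint_level x y 0 b) =
      card (joint_level x y (-1) b) + card (joint_level x y 0 b)"
    by (intro card_Un_disjoint) (auto simp: joint_level_def level_set_def)
  finally show ?thesis .
qed

text \<open>Only coordinates where both entries are nonzero contribute, with 1 for equal signs and
  -1 for opposite ones. This is the quantity tested by \<open>P_ind\<close>.\<close>

lemma scalar_prod_joint_level:
  assumes x: "x \<in> ternary_vecs n km1 k0 k1" and y: "y \<in> ternary_vecs n km1 k0 k1"
  shows "x \<bullet> y = int (card (joint_level x y 1 1)) - int (card (joint_level x y (-1) 1))
    + int (card (joint_level x y (-1) (-1))) - int (card (joint_level x y 1 (-1)))"
proof -
  note dims = ternary_vecsD(1)[OF x] ternary_vecsD(1)[OF y]
  \<comment> \<open>Cardinalities become sums of indicators, which reduces the identity to a check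
    at each coordinate.\<close>
  have card_eq: "int (card (joint_level x y a b)) = (\<Sum>i<n. of_bool (x $ i = a \<and> y $ i = b))"
    for a b
  proof -
    have "joint_level x y a b = {i \<in> {..<n}. x $ i = a \<and> y $ i = b}"
      using dims by (auto simp: joint_level_def level_set_def)
    then show ?thesis
      by (simp add: of_bool_def sum.If_cases Int_def)
  qed
  have "x \<bullet> y = (\<Sum>i<n. x $ i * y $ i)"
    using dims by (simp add: scalar_prod_def atLeast0LessThan)
  also have "\<dots> = (\<Sum>i<n. of_bool (x $ i = 1 \<and> y $ i = 1) - of_bool (x $ i = -1 \<and> y $ i = 1)
      + of_bool (x $ i = -1 \<and> y $ i = -1) - of_bool (x $ i = 1 \<and> y $ i = -1))"
  proof (intro sum.cong refl)
    fix i assume "i \<in> {..<n}"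
    then have "x $ i = -1 \<or> x $ i = 0 \<or> x $ i = 1" "y $ i = -1 \<or> y $ i = 0 \<or> y $ i = 1"
      using ternary_vecsD(2)[OF x] ternary_vecsD(2)[OF y] by simp_all
    then show "x $ i * y $ i = of_bool (x $ i = 1 \<and> y $ i = 1) - of_bool (x $ i = -1 \<and> y $ i = 1)
      + of_bool (x $ i = -1 \<and> y $ i = -1) - of_bool (x $ i = 1 \<and> y $ i = -1)"
      by (elim disjE) simp_all
  qed
  finally show ?thesis
    by (simp add: card_eq sum.distrib sum_subtractf)
qed

text \<open>The dot product is at most the number of nonzero entries of \<open>y\<close>. For larger
  \<open>t\<close> the whole vector set is admissible.\<close>

lemma scalar_prod_ternary_le:
  assumes x: "x \<in> ternary_vecs n km1 k0 k1" and y: "y \<in> ternary_vecs n km1 k0 k1"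
  shows "x \<bullet> y \<le> int (km1 + k1)"
  using card_level_set_split[OF x ternary_vecsD(1)[OF y], of 1]
    card_level_set_split[OF x ternary_vecsD(1)[OF y], of "-1"]
    ternary_vecsD(3,5)[OF y] scalar_prod_joint_level[OF x y]
  by linarith

lemma scalar_prod_ternary_self:
  assumes x: "x \<in> ternary_vecs n km1 k0 k1"
  shows "x \<bullet> x = int (km1 + k1)"
proof -
  have "joint_level x x a b = (if a = b then level_set x a else {})" for a b
    by (auto simp: joint_level_def level_set_def)
  then show ?thesis
    using scalar_prod_joint_level[OF x x] ternary_vecsD(3,5)[OF x] by simp
qed

text \<open>The sets with \<open>b\<close> equal to 1 or -1 locate all nonzero entries of the second
  vector; its other entries are 0.\<close>

lemma ternary_vec_eqI:
  assumes x: "x \<in> ternary_vecs n km1 k0 k1"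
    and y: "y \<in> ternary_vecs n km1 k0 k1" and z: "z \<in> ternary_vecs n km1 k0 k1"
    and eq: "\<And>a b. a \<in> {-1, 0, 1} \<Longrightarrow> b \<in> {-1, 1} \<Longrightarrow> joint_level x y a b = joint_level x z a b"
  shows "y = z"
proof (rule eq_vecI)
  note dims = ternary_vecsD(1)[OF x] ternary_vecsD(1)[OF y] ternary_vecsD(1)[OF z]
  show "dim_vec y = dim_vec z"
    using dims by simp
  fix i assume "i < dim_vec z"
  then have i: "i < n"
    using dims by simp
  have "y $ i = b \<longleftrightarrow> z $ i = b" if "b \<in> {-1, 1}" for b
  proof -
    have "x $ i \<in> {-1, 0, 1}"
      using ternary_vecsD(2)[OF x i] by auto
    from eq[OF this that] have "i \<in> joint_level x y (x $ i) b \<longleftrightarrow> i \<in> joint_level x z (x $ i) b"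
      by simp
    then show ?thesis
      using i dims by (simp add: joint_level_def level_set_def)
  qed
  from this[of 1] this[of "-1"] show "y $ i = z $ i"
    using ternary_vecsD(2)[OF y i] ternary_vecsD(2)[OF z i] by auto
qed

section \<open>Bounding the neighbours of one vector by joint type\<close>

definition joint_type :: "int vec \<Rightarrow> int vec \<Rightarrow> int \<times> int \<times> int \<times> int" where
  "joint_type x y =
    (int (card (joint_level x y 1 1)), int (card (joint_level x y (-1) (-1))),
     int (card (joint_level x y (-1) 1)), int (card (joint_level x y 1 (-1))))"

text \<open>On each of the three level sets of \<open>x\<close>, the places where \<open>y\<close>
  is 1 and where it is -1 form a disjoint pair of prescribed sizes. These three pairs determine
  \<open>y\<close>, and each contributes two binomial factors.\<close>

lemma card_joint_type_le:
  assumes x: "x \<in> ternary_vecs n km1 k0 k1"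
  shows "card {y \<in> ternary_vecs n km1 k0 k1. joint_type x y = (lpp, lmm, lmp, lpm)} \<le>
    int_binom (int k1) lpp * int_binom (int k1 - lpp) lpm *
    int_binom (int km1) lmm * int_binom (int km1 - lmm) lmp *
    int_binom (int k0) (int k1 - lpp - lmp) *
    int_binom (int k0 - int k1 + lpp + lmp) (int km1 - lmm - lpm)" (is "card ?F \<le> ?R")
proof -
  define f where "f y =
    ((joint_level x y 1 1, joint_level x y 1 (-1)),
     (joint_level x y (-1) (-1), joint_level x y (-1) 1),
     (joint_level x y 0 1, joint_level x y 0 (-1)))" for y
  let ?T = "disjoint_pairs (level_set x 1) lpp lpm \<times>
    disjoint_pairs (level_set x (-1)) lmm lmp \<times>
    disjoint_pairs (level_set x 0) (int k1 - lpp - lmp) (int km1 - lmm - lpm)"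
  have "inj_on f ?F"
  proof (rule inj_onI)
    fix y z assume "y \<in> ?F" "z \<in> ?F" and "f y = f z"
    then show "y = z"
      by (intro ternary_vec_eqI[OF x]) (auto simp: f_def)
  qed
  moreover have "f ` ?F \<subseteq> ?T"
  proof
    fix p assume "p \<in> f ` ?F"
    then obtain y where y: "y \<in> ternary_vecs n km1 k0 k1"
      and ty: "joint_type x y = (lpp, lmm, lmp, lpm)" and p: "p = f y"
      by auto
    \<comment> \<open>The type does not record the level 0 of \<open>x\<close>; the sizes there are
      forced by the totals \<open>k1\<close> and \<open>km1\<close> of \<open>y\<close>.\<close>
    have "int (card (joint_level x y 0 1)) = int k1 - lpp - lmp"
      "int (card (joint_level x y 0 (-1))) = int km1 - lmm - lpm"
      using card_level_set_split[OF x ternary_vecsD(1)[OF y], of 1]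
        card_level_set_split[OF x ternary_vecsD(1)[OF y], of "-1"]
        ternary_vecsD(3,5)[OF y] ty
      by (auto simp: joint_type_def)
    with ty show "p \<in> ?T"
      by (auto simp: p f_def joint_type_def disjoint_pairs_def joint_level_def level_set_def)
  qed
  ultimately have "card ?F \<le> card ?T"
    by (intro card_inj_on_le finite_cartesian_product finite_disjoint_pairs finite_level_set)
  also have "card ?T = ?R"
    using ternary_vecsD(3-5)[OF x]
    by (simp add: card_cartesian_product card_disjoint_pairs algebra_simps)
  finally show ?thesis .
qed

text \<open>Each minimum in \<open>B_set\<close> combines a bound from splitting a level set of
  \<open>x\<close> with one from splitting a level set of \<open>y\<close>.\<close>

lemma joint_type_in_B_set:
  assumes x: "x \<in> ternary_vecs n km1 k0 k1" and y: "y \<in> ternary_vecs n km1 k0 k1"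
  shows "joint_type x y \<in> B_set km1 k1"
  using card_level_set_split[OF x ternary_vecsD(1)[OF y], of 1]
    card_level_set_split[OF x ternary_vecsD(1)[OF y], of "-1"]
    card_level_set_split[OF y ternary_vecsD(1)[OF x], of 1]
    card_level_set_split[OF y ternary_vecsD(1)[OF x], of "-1"]
    ternary_vecsD(3,5)[OF x] ternary_vecsD(3,5)[OF y]
  by (auto simp: B_set_def joint_type_def joint_level_commute[of y x])

text \<open>The dot product depends only on the joint type, so each type lies entirely inside or
  entirely outside the set counted, as \<open>P_ind\<close> records.\<close>

lemma card_scalar_prod_ge_le_d_num:
  assumes x: "x \<in> ternary_vecs n km1 k0 k1"
  shows "card {y \<in> ternary_vecs n km1 k0 k1. x \<bullet> y \<ge> t} \<le> d_num n km1 k0 k1 t" (is "card ?N \<le> _")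
proof -
  define F where "F l = {y \<in> ?N. joint_type x y = l}" for l
  have "?N \<subseteq> (\<Union>l \<in> B_set km1 k1. F l)"
    using joint_type_in_B_set[OF x] by (auto simp: F_def)
  then have "card ?N \<le> card (\<Union>l \<in> B_set km1 k1. F l)"
    by (intro card_mono) (auto simp: F_def finite_B_set finite_ternary_vecs)
  also have "\<dots> \<le> (\<Sum>l \<in> B_set km1 k1. card (F l))"
    by (intro card_UN_le finite_B_set)
  also have "\<dots> \<le> d_num n km1 k0 k1 t"
    unfolding d_num_def
  proof (intro sum_mono, clarify)
    fix lpp lmm lmp lpm
    show "card (F (lpp, lmm, lmp, lpm)) \<le>
        int_binom (int k1) lpp * int_binom (int k1 - lpp) lpm *
        int_binom (int km1) lmm * int_binom (int km1 - lmm) lmp *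
        int_binom (int k0) (int k1 - lpp - lmp) *
        int_binom (int k0 - int k1 + lpp + lmp) (int km1 - lmm - lpm) *
        P_ind lpp lmp lmm lpm t"
    proof (cases "lpp - lmp + lmm - lpm \<ge> t")
      case True
      have "card (F (lpp, lmm, lmp, lpm)) \<le>
          card {y \<in> ternary_vecs n km1 k0 k1. joint_type x y = (lpp, lmm, lmp, lpm)}"
        by (intro card_mono) (auto simp: F_def finite_ternary_vecs)
      with card_joint_type_le[OF x, of lpp lmm lmp lpm] True show ?thesis
        by (simp add: P_ind_def)
    next
      case False
      then have "F (lpp, lmm, lmp, lpm) = {}"
        using scalar_prod_joint_level[OF x] by (auto simp: F_def joint_type_def)
      then show ?thesis
        by simp
    qed
  qed
  finally show ?thesis .
qed

section \<open>Extremal sets and the covering bound\<close>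

lemma h_num_attained:
  obtains W where "W \<subseteq> ternary_vecs n km1 k0 k1" "pairwise (\<lambda>x y. x \<bullet> y < t) W"
    "card W = h_num n km1 k0 k1 t"
proof -
  have "h_num n km1 k0 k1 t \<in>
      {card W | W. W \<subseteq> ternary_vecs n km1 k0 k1 \<and> pairwise (\<lambda>x y. x \<bullet> y < t) W}"
    unfolding h_num_def
    by (rule Max_in[OF finite_card_pairwise_subsets card_pairwise_subsets_nonempty])
  then show ?thesis
    by (elim CollectE exE conjE) (rule that, simp_all)
qed

lemma card_le_h_num:
  assumes "W \<subseteq> ternary_vecs n km1 k0 k1" "pairwise (\<lambda>x y. x \<bullet> y < t) W"
  shows "card W \<le> h_num n km1 k0 k1 t"
  unfolding h_num_def
  by (rule Max_ge[OF finite_card_pairwise_subsets], rule CollectI, rule exI[of _ W])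
    (simp add: assms)

lemma h_num_le_m_num: "h_num n km1 k0 k1 t \<le> m_num n km1 k0 k1 t"
proof -
  obtain W where W: "W \<subseteq> ternary_vecs n km1 k0 k1" "pairwise (\<lambda>x y. x \<bullet> y < t) W"
    "card W = h_num n km1 k0 k1 t"
    by (rule h_num_attained)
  have "pairwise (\<lambda>x y. x \<bullet> y \<noteq> t) W"
    using W(2) by (force simp: pairwise_def)
  with W(1) have "card W \<le> m_num n km1 k0 k1 t"
    unfolding m_num_def
    by (intro Max_ge[OF finite_card_pairwise_subsets] CollectI exI[of _ W]) simp
  with W(3) show ?thesis
    by simp
qed

lemma card_ternary_vecs_le:
  assumes "d_num n km1 k0 k1 t \<noteq> 0"
  shows "card (ternary_vecs n km1 k0 k1) \<le> h_num n km1 k0 k1 t * d_num n km1 k0 k1 t"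
    (is "card ?V \<le> ?h * ?d")
proof (cases "t \<le> int (km1 + k1)")
  case False
  \<comment> \<open>Here \<open>t\<close> exceeds every dot product, so the whole set competes in
    \<open>h_num\<close>; the factor \<open>?d\<close> is at least 1.\<close>
  then have "pairwise (\<lambda>x y. x \<bullet> y < t) ?V"
    by (force simp: pairwise_def dest: scalar_prod_ternary_le)
  then have "card ?V \<le> ?h"
    by (intro card_le_h_num) auto
  also have "\<dots> \<le> ?h * ?d"
    using assms by simp
  finally show ?thesis .
next
  case True
  obtain W where W: "W \<subseteq> ?V" "pairwise (\<lambda>x y. x \<bullet> y < t) W" "card W = ?h"
    by (rule h_num_attained)
  have finW: "finite W"
    using W(1) finite_ternary_vecs finite_subset by blast
  have "?V \<subseteq> (\<Union>w \<in> W. {y \<in> ?V. w \<bullet> y \<ge> t})"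
  proof
    fix y assume y: "y \<in> ?V"
    have "\<exists>w \<in> W. w \<bullet> y \<ge> t"
    proof (cases "y \<in> W")
      case True
      \<comment> \<open>A member of \<open>W\<close> covers itself, its product with itself being
        \<open>km1 + k1\<close>.\<close>
      then show ?thesis
        using \<open>t \<le> int (km1 + k1)\<close> scalar_prod_ternary_self[OF y] by (intro bexI[of _ y]) simp_all
    next
      case False
      show ?thesis
      proof (rule ccontr)
        assume "\<not> ?thesis"
        then have less: "w \<bullet> y < t" if "w \<in> W" for w
          using that by auto
        \<comment> \<open>\<open>pairwise\<close> ranges over ordered pairs, so enlarging
          \<open>W\<close> by \<open>y\<close> requires both orders of the product. The enlarged set
          then contradicts the maximality of \<open>card W\<close>.\<close>
        moreover have "y \<bullet> w = w \<bullet> y" if "w \<in> W" for w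
          using that W(1) y by (intro comm_scalar_prod[of _ n]) (auto simp: ternary_vecs_def)
        ultimately have "pairwise (\<lambda>x y. x \<bullet> y < t) (insert y W)"
          using W(2) by (auto simp: pairwise_insert)
        then have "card (insert y W) \<le> ?h"
          using W(1) y by (intro card_le_h_num) auto
        then show False
          using W(3) False finW by simp
      qed
    qed
    with y show "y \<in> (\<Union>w \<in> W. {y \<in> ?V. w \<bullet> y \<ge> t})"
      by auto
  qed
  then have "card ?V \<le> card (\<Union>w \<in> W. {y \<in> ?V. w \<bullet> y \<ge> t})"
    by (intro card_mono) (auto simp: finW finite_ternary_vecs)
  also have "\<dots> \<le> (\<Sum>w \<in> W. card {y \<in> ?V. w \<bullet> y \<ge> t})"
    by (intro card_UN_le finW)
  also have "\<dots> \<le> of_nat (card W) * ?d"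
    using W(1) by (intro sum_bounded_above card_scalar_prod_ge_le_d_num) auto
  finally show ?thesis
    by (simp add: W(3))
qed

theorem mainTheorem1:
  fixes km1 k0 k1 n :: nat and t :: int
  assumes "n = km1 + k0 + k1"
    and "d_num n km1 k0 k1 t \<noteq> 0"
  shows "m_num n km1 k0 k1 t \<ge> h_num n km1 k0 k1 t \<and>
         int (h_num n km1 k0 k1 t)
           \<ge> \<lceil>real (card (ternary_vecs n km1 k0 k1)) / real (d_num n km1 k0 k1 t)\<rceil>"
proof
  show "m_num n km1 k0 k1 t \<ge> h_num n km1 k0 k1 t"
    by (rule h_num_le_m_num)
  \<comment> \<open>Since \<open>h_num\<close> is an integer, bounding the ceiling amounts to
    bounding the quotient; this is that bound multiplied by the positive denominator.\<close>
  have "real (card (ternary_vecs n km1 k0 k1)) \<le> real (h_num n km1 k0 k1 t) * real (d_num n km1 k0 k1 t)"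
    using card_ternary_vecs_le[OF assms(2)] by (metis of_nat_le_iff of_nat_mult)
  then show "int (h_num n km1 k0 k1 t)
      \<ge> \<lceil>real (card (ternary_vecs n km1 k0 k1)) / real (d_num n km1 k0 k1 t)\<rceil>"
    using assms(2) by (simp add: ceiling_le_iff divide_le_eq)
qed

end
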